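(* Let $V$ be a variety of universal algebras and let $F$ be the free algebra of $V$ freely generated by $X=\{x_1,\dots,x_n\}$. Let $\Phi$ be an automorphism of $\mathrm{End}(F)$ and let $\varphi$ be the permutation of $F^n$ corresponding to $\Phi$. Then $\Phi$ is quasi-inner if and only if $\varphi$ is equal in effect to a direct product $\psi=s_1\times\dots\times s_n$ of $n$ permutations $s_1,\dots,s_n$ of $F$.
   Context: $\mathrm{End}(F)$ is the semigroup of all endomorphisms of $F$ under composition. An automorphism $\Phi$ of $\mathrm{End}(F)$ is quasi-inner if there is a bijection $s$ of the set $F$ onto itself such that $\Phi(\nu)=s\circ\nu\circ s^{-1}$ for every endomorphism $\nu$ of $F$. $F^n$ is the direct power of $n$ copies of $F$; $\Delta=\{(u,\dots,u):u\in F\}$ is its diagonal and $\delta:F\to\Delta$, $\delta(u)=(u,\dots,u)$. For $\nu\in\mathrm{End}(F)$, $\nu^{\times n}=\nu\times\dots\times\nu$ acts on $F^n$ componentwise. For $\vec u=(u_1,\dots,u_n)\in F^n$, $\alpha_{\vec u}$ is the unique endomorphism of $F$ with $\alpha_{\vec u}(x_i)=u_i$ for all $i$. The permutation $\varphi$ of $F^n$ corresponding to $\Phi$ is defined by: $\varphi(\vec u)=\vec v$ iff $\Phi(\alpha_{\vec u})=\alpha_{\vec v}$. A permutation $\psi$ of $F^n$ determines the automorphism $\Phi$ if for every $\nu\in\mathrm{End}(F)$ the map $\psi\circ\nu^{\times n}\circ\psi^{-1}$ sends $\Delta$ into $\Delta$ and $\Phi(\nu)=\delta^{-1}\circ\psi\circ\nu^{\times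 n}\circ\psi^{-1}\circ\delta$; the corresponding permutation $\varphi$ determines $\Phi$ in this sense. Two permutations of $F^n$ are equal in effect if they determine the same automorphism of $\mathrm{End}(F)$. *)

theory Defs
  imports "HOL-Algebra.Bij"
begin

section \<open>Universal algebras\<close>

text \<open>
  A signature is a partial map \<open>S\<close> from operation symbols to arities: its domain is the set of
  symbols, so the empty signature is allowed. Operations are applied to argument lists; their
  values on lists of the wrong length or with entries outside the carrier are irrelevant.
\<close>

record ('f, 'a) algebra = "'a partial_object" +
  ops :: "'f \<Rightarrow> 'a list \<Rightarrow> 'a"

definition is_algebra :: "('f \<Rightarrow> nat option) \<Rightarrow> ('f, 'a) algebra \<Rightarrow> bool" where
  "is_algebra S A \<longleftrightarrow> carrier A \<noteq> {} \<and>
     (\<forall>f as. S f = Some (length as) \<longrightarrow> set as \<subseteq> carrier A \<longrightarrow> ops A f as \<in> carrier A)"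

definition alg_hom ::
  "('f \<Rightarrow> nat option) \<Rightarrow> ('f, 'a) algebra \<Rightarrow> ('f, 'b) algebra \<Rightarrow> ('a \<Rightarrow> 'b) set" where
  "alg_hom S A B = {h \<in> carrier A \<rightarrow>\<^sub>E carrier B.
     \<forall>f as. S f = Some (length as) \<longrightarrow> set as \<subseteq> carrier A \<longrightarrow>
       h (ops A f as) = ops B f (map h as)}"

inductive_set generated ::
  "('f \<Rightarrow> nat option) \<Rightarrow> ('f, 'a) algebra \<Rightarrow> 'a set \<Rightarrow> 'a set"
  for S A X where
    base: "a \<in> X \<Longrightarrow> a \<in> generated S A X"
  | step: "S f = Some (length as) \<Longrightarrow> \<forall>a\<in>set as. a \<in> generated S A X \<Longrightarrow>
             ops A f as \<in> generated S A X"


section \<open>Varieties\<close>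

datatype ('f, 'v) trm = Var 'v | Op 'f "('f, 'v) trm list"

primrec wf_trm :: "('f \<Rightarrow> nat option) \<Rightarrow> ('f, 'v) trm \<Rightarrow> bool" where
  "wf_trm S (Var v) \<longleftrightarrow> True"
| "wf_trm S (Op f ts) \<longleftrightarrow> S f = Some (length ts) \<and> list_all (wf_trm S) ts"

primrec eval :: "('f, 'a) algebra \<Rightarrow> ('v \<Rightarrow> 'a) \<Rightarrow> ('f, 'v) trm \<Rightarrow> 'a" where
  "eval A \<rho> (Var v) = \<rho> v"
| "eval A \<rho> (Op f ts) = ops A f (map (eval A \<rho>) ts)"

text \<open>
  A variety is the class of all algebras of a signature satisfying a set \<open>E\<close> of identities in
  countably many variables. It is represented by \<open>E\<close>, since its members live on arbitrary types.
\<close>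

definition is_identities ::
  "('f \<Rightarrow> nat option) \<Rightarrow> (('f, nat) trm \<times> ('f, nat) trm) set \<Rightarrow> bool" where
  "is_identities S E \<longleftrightarrow> (\<forall>(l, r)\<in>E. wf_trm S l \<and> wf_trm S r)"

definition in_variety ::
  "('f \<Rightarrow> nat option) \<Rightarrow> (('f, nat) trm \<times> ('f, nat) trm) set \<Rightarrow> ('f, 'a) algebra \<Rightarrow> bool" where
  "in_variety S E A \<longleftrightarrow> is_algebra S A \<and>
     (\<forall>(l, r)\<in>E. \<forall>\<rho>. range \<rho> \<subseteq> carrier A \<longrightarrow> eval A \<rho> l = eval A \<rho> r)"

text \<open>
  HOL cannot quantify over types inside a formula, so the universal mapping property is required
  for all algebras of the variety carried by sets of terms over the type of \<open>F\<close>. That type is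
  large enough to hold a copy of every algebra of the variety generated by an image of \<open>X\<close>; hence
  the property holds for algebras of the variety on any type (lemma
  \<open>freely_generated_extension\<close>).
\<close>

definition freely_generated ::
  "('f \<Rightarrow> nat option) \<Rightarrow> (('f, nat) trm \<times> ('f, nat) trm) set \<Rightarrow> ('f, 'a) algebra \<Rightarrow> 'a set
     \<Rightarrow> bool" where
  "freely_generated S E F X \<longleftrightarrow>
     in_variety S E F \<and> X \<subseteq> carrier F \<and> generated S F X = carrier F \<and>
     (\<forall>A :: ('f, ('f, 'a) trm set) algebra. in_variety S E A \<longrightarrow>
        (\<forall>g\<in>X \<rightarrow> carrier A. \<exists>h\<in>alg_hom S F A. \<forall>a\<in>X. h a = g a))"

lemma generated_subset:
  assumes "is_algebra S A" "X \<subseteq> carrier A"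
  shows "generated S A X \<subseteq> carrier A"
proof
  fix a assume "a \<in> generated S A X"
  then show "a \<in> carrier A"
  proof induction
    case (step f as)
    then have "set as \<subseteq> carrier A" by auto
    with step assms(1) show ?case by (simp add: is_algebra_def)
  qed (use assms(2) in auto)
qed

lemma alg_hom_eq_on_generated:
  assumes A: "is_algebra S A" "X \<subseteq> carrier A"
    and h: "h \<in> alg_hom S A B" "h' \<in> alg_hom S A B" "\<forall>a\<in>X. h a = h' a"
    and a: "a \<in> generated S A X"
  shows "h a = h' a"
  using a
proof induction
  case (step f as)
  then have "set as \<subseteq> carrier A" using generated_subset[OF A] by auto
  moreover have "map h as = map h' as" using step by simp
  ultimately show ?case using step(1) h(1,2) by (simp add: alg_hom_def del: map_eq_conv)
qed (use h in auto)

lemma eval_in_carrier: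
  assumes "is_algebra S A" "range \<rho> \<subseteq> carrier A" "wf_trm S t"
  shows "eval A \<rho> t \<in> carrier A"
  using assms(3)
proof (induction t)
  case (Op f ts)
  then have "set (map (eval A \<rho>) ts) \<subseteq> carrier A" by (auto simp: list_all_iff)
  with Op assms(1) show ?case by (simp add: is_algebra_def)
qed (use assms(2) in auto)

lemma generated_eval:
  assumes "b \<in> generated S A (g ` X)"
  shows "\<exists>t. wf_trm S t \<and> eval A g t = b"
  using assms
proof induction
  case (base a)
  then obtain y where "a = g y" by auto
  then have "wf_trm S (Var y) \<and> eval A g (Var y) = a" by simp
  then show ?case by blast
next
  case (step f as)
  then obtain T where T: "\<forall>a\<in>set as. wf_trm S (T a) \<and> eval A g (T a) = a" by metis
  have "map (\<lambda>a. eval A g (T a)) as = as" using T by (simp add: map_idI)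
  then have "eval A g (Op f (map T as)) = ops A f as" by (simp add: comp_def)
  moreover have "wf_trm S (Op f (map T as))" using T step by (simp add: list_all_iff)
  ultimately show ?case by blast
qed

theorem freely_generated_extension:
  fixes A :: "('f, 'b) algebra" and F :: "('f, 'a) algebra"
  assumes F: "freely_generated S E F X" and E: "is_identities S E"
    and A: "in_variety S E A" and g: "g \<in> X \<rightarrow> carrier A"
  shows "\<exists>!h. h \<in> alg_hom S F A \<and> (\<forall>a\<in>X. h a = g a)"
proof (rule ex_ex1I)
  have alg: "is_algebra S F" "is_algebra S A" and X: "X \<subseteq> carrier F"
    and gen: "generated S F X = carrier F"
    using F A by (auto simp: freely_generated_def in_variety_def)
  define B where "B = generated S A (g ` X)"
  have gX: "g ` X \<subseteq> carrier A" using g by auto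
  have BA: "B \<subseteq> carrier A" unfolding B_def by (rule generated_subset[OF alg(2) gX])
  define k :: "'b \<Rightarrow> ('f, 'a) trm set" where "k b = {t. wf_trm S t \<and> eval A g t = b}" for b
  have kne: "k b \<noteq> {}" if "b \<in> B" for b
    using generated_eval[of b S A g X] that by (auto simp: k_def B_def)
  have inj: "inj_on k B"
  proof (rule inj_onI)
    fix b c assume "b \<in> B" "k b = k c"
    then obtain t where "t \<in> k b" "t \<in> k c" using kne by blast
    then show "b = c" by (simp add: k_def)
  qed
  define j where "j = inv_into B k"
  have jk: "j (k b) = b" if "b \<in> B" for b using that inj by (simp add: j_def)
  have jB: "j c \<in> B" "k (j c) = c" if "c \<in> k ` B" for c
    using that by (auto simp: j_def inv_into_into f_inv_into_f)
  have Bop: "ops A f as \<in> B" if "S f = Some (length as)" "set as \<subseteq> B" for f as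
    using that unfolding B_def by (auto intro!: generated.step)
  define C :: "('f, ('f, 'a) trm set) algebra"
    where "C = \<lparr>carrier = k ` B, ops = (\<lambda>f cs. k (ops A f (map j cs)))\<rparr>"
  have Bne: "B \<noteq> {}"
  proof -
    obtain a where "a \<in> generated S F X" using gen alg(1) by (auto simp: is_algebra_def)
    then have "\<exists>b. b \<in> B"
    proof induction
      case (base a)
      then show ?case unfolding B_def by (blast intro: generated.base)
    next
      case (step f as)
      show ?case
      proof (cases "as = []")
        case True
        then show ?thesis using step Bop[of f "[]"] by auto
      next
        case False
        then show ?thesis using step by (auto simp: neq_Nil_conv)
      qed
    qed
    then show ?thesis by auto
  qed
  have Calg: "is_algebra S C"
    unfolding is_algebra_def
  proof (intro conjI allI impI)
    show "carrier C \<noteq> {}" using Bne by (simp add: C_def)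
    fix f cs assume "S f = Some (length cs)" "set cs \<subseteq> carrier C"
    then have "ops A f (map j cs) \<in> B" using jB(1) by (intro Bop) (auto simp: C_def)
    then show "ops C f cs \<in> carrier C" by (simp add: C_def)
  qed
  have Ceval: "eval A (j \<circ> \<rho>) t = j (eval C \<rho> t)"
    if "range \<rho> \<subseteq> carrier C" "wf_trm S t" for \<rho> and t :: "('f, nat) trm"
    using that(2)
  proof (induction t)
    case (Op f ts)
    then have wf: "\<forall>t\<in>set ts. wf_trm S t" by (simp add: list_all_iff)
    have "set (map j (map (eval C \<rho>) ts)) \<subseteq> B"
      using wf eval_in_carrier[OF Calg that(1)] jB(1) by (auto simp: C_def)
    then have "ops A f (map j (map (eval C \<rho>) ts)) \<in> B"
      using Op.prems by (intro Bop) auto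
    moreover have "map (eval A (j \<circ> \<rho>)) ts = map j (map (eval C \<rho>) ts)"
      using Op.IH wf by (simp add: comp_def)
    moreover have "ops C f cs = k (ops A f (map j cs))" for cs by (simp add: C_def)
    ultimately show ?case by (simp only: eval.simps jk)
  qed simp
  have "in_variety S E C"
    unfolding in_variety_def
  proof (intro conjI Calg ballI, clarify)
    fix l r and \<rho> :: "nat \<Rightarrow> _" assume lr: "(l, r) \<in> E" and \<rho>: "range \<rho> \<subseteq> carrier C"
    have wf: "wf_trm S l" "wf_trm S r" using E lr by (auto simp: is_identities_def)
    have "(j \<circ> \<rho>) i \<in> carrier A" for i
    proof -
      have "\<rho> i \<in> k ` B" using \<rho> by (auto simp: C_def)
      then show ?thesis using jB(1) BA by auto
    qed
    then have "range (j \<circ> \<rho>) \<subseteq> carrier A" by blast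
    then have "eval A (j \<circ> \<rho>) l = eval A (j \<circ> \<rho>) r"
      using A lr by (auto simp: in_variety_def)
    then have "j (eval C \<rho> l) = j (eval C \<rho> r)" using Ceval[OF \<rho>] wf by simp
    moreover have "eval C \<rho> l \<in> k ` B" "eval C \<rho> r \<in> k ` B"
      using eval_in_carrier[OF Calg \<rho>] wf by (auto simp: C_def)
    ultimately show "eval C \<rho> l = eval C \<rho> r" using jB(2) by metis
  qed
  moreover have "k \<circ> g \<in> X \<rightarrow> carrier C"
    by (auto simp: C_def B_def intro!: imageI generated.base)
  ultimately obtain h where h: "h \<in> alg_hom S F C" "\<forall>a\<in>X. h a = k (g a)"
    using F unfolding freely_generated_def by (metis comp_apply)
  have hB: "h a \<in> k ` B" if "a \<in> carrier F" for a
    using h(1) that by (auto simp: alg_hom_def C_def)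
  define h' where "h' = (\<lambda>a\<in>carrier F. j (h a))"
  have "h' \<in> alg_hom S F A"
    unfolding alg_hom_def
  proof (intro CollectI conjI allI impI)
    show "h' \<in> carrier F \<rightarrow>\<^sub>E carrier A" using hB jB(1) BA by (auto simp: h'_def)
    fix f as assume f: "S f = Some (length as)" and as: "set as \<subseteq> carrier F"
    have "set (map j (map h as)) \<subseteq> B" using as hB jB(1) by auto
    then have "ops A f (map j (map h as)) \<in> B" using f by (intro Bop) auto
    then have "j (h (ops F f as)) = ops A f (map j (map h as))"
      using h(1) f as jk by (simp add: alg_hom_def C_def)
    moreover have "h' (ops F f as) = j (h (ops F f as))"
      using alg(1) f as by (simp add: is_algebra_def h'_def)
    moreover have "map h' as = map j (map h as)" using as by (auto simp: h'_def)
    ultimately show "h' (ops F f as) = ops A f (map h' as)" by (simp only:)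
  qed
  moreover have "\<forall>a\<in>X. h' a = g a"
  proof
    fix a assume a: "a \<in> X"
    then have "g a \<in> B" unfolding B_def by (blast intro: generated.base)
    then show "h' a = g a" using a h(2) X jk by (auto simp: h'_def)
  qed
  ultimately show "\<exists>h. h \<in> alg_hom S F A \<and> (\<forall>a\<in>X. h a = g a)" by blast
  fix h1 h2
  assume h1: "h1 \<in> alg_hom S F A \<and> (\<forall>a\<in>X. h1 a = g a)"
    and h2: "h2 \<in> alg_hom S F A \<and> (\<forall>a\<in>X. h2 a = g a)"
  show "h1 = h2"
  proof (rule extensionalityI[of _ "carrier F"])
    show "h1 \<in> extensional (carrier F)" "h2 \<in> extensional (carrier F)"
      using h1 h2 by (auto simp: alg_hom_def PiE_def)
    show "h1 a = h2 a" if "a \<in> carrier F" for a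
      using alg_hom_eq_on_generated[OF alg(1) X, of h1 A h2 a] h1 h2 that gen by auto
  qed
qed


section \<open>The endomorphism semigroup and its automorphisms\<close>

text \<open>
  \<open>hom\<close> for the record below asks only for compatibility with composition, so
  \<open>auto (End S F)\<close> consists of the semigroup automorphisms, as functions extensional on the
  endomorphisms.
\<close>

definition End :: "('f \<Rightarrow> nat option) \<Rightarrow> ('f, 'a) algebra \<Rightarrow> ('a \<Rightarrow> 'a) monoid" where
  "End S F = \<lparr>carrier = alg_hom S F F, mult = compose (carrier F), one = (\<lambda>a\<in>carrier F. a)\<rparr>"

definition quasi_inner ::
  "('f \<Rightarrow> nat option) \<Rightarrow> ('f, 'a) algebra \<Rightarrow> (('a \<Rightarrow> 'a) \<Rightarrow> ('a \<Rightarrow> 'a)) \<Rightarrow> bool" where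
  "quasi_inner S F \<Phi> \<longleftrightarrow> (\<exists>s\<in>Bij (carrier F). \<forall>\<nu>\<in>carrier (End S F).
     \<Phi> \<nu> = compose (carrier F) s (compose (carrier F) \<nu> (inv_into (carrier F) s)))"


section \<open>Permutations of the direct power\<close>

text \<open>Tuples of length \<open>n\<close> are functions on \<open>{1..n}\<close>, made \<open>undefined\<close> elsewhere.\<close>

definition power_set :: "nat \<Rightarrow> 'a set \<Rightarrow> (nat \<Rightarrow> 'a) set" where
  "power_set n C = {1..n} \<rightarrow>\<^sub>E C"

definition diag :: "nat \<Rightarrow> 'a \<Rightarrow> (nat \<Rightarrow> 'a)" where
  "diag n a = (\<lambda>i\<in>{1..n}. a)"

definition Diagonal :: "nat \<Rightarrow> 'a set \<Rightarrow> (nat \<Rightarrow> 'a) set" where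
  "Diagonal n C = diag n ` C"

definition direct_product ::
  "nat \<Rightarrow> 'a set \<Rightarrow> (nat \<Rightarrow> 'a \<Rightarrow> 'a) \<Rightarrow> (nat \<Rightarrow> 'a) \<Rightarrow> (nat \<Rightarrow> 'a)" where
  "direct_product n C s = (\<lambda>u\<in>power_set n C. \<lambda>i\<in>{1..n}. s i (u i))"

definition map_power :: "nat \<Rightarrow> 'a set \<Rightarrow> ('a \<Rightarrow> 'a) \<Rightarrow> (nat \<Rightarrow> 'a) \<Rightarrow> (nat \<Rightarrow> 'a)" where
  "map_power n C \<nu> = direct_product n C (\<lambda>i. \<nu>)"

definition endo_of ::
  "('f \<Rightarrow> nat option) \<Rightarrow> ('f, 'a) algebra \<Rightarrow> nat \<Rightarrow> (nat \<Rightarrow> 'a) \<Rightarrow> (nat \<Rightarrow> 'a) \<Rightarrow> ('a \<Rightarrow> 'a)" where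
  "endo_of S F n x u = (THE \<alpha>. \<alpha> \<in> carrier (End S F) \<and> (\<forall>i\<in>{1..n}. \<alpha> (x i) = u i))"

definition corresponding_perm ::
  "('f \<Rightarrow> nat option) \<Rightarrow> ('f, 'a) algebra \<Rightarrow> nat \<Rightarrow> (nat \<Rightarrow> 'a) \<Rightarrow> (('a \<Rightarrow> 'a) \<Rightarrow> ('a \<Rightarrow> 'a))
     \<Rightarrow> (nat \<Rightarrow> 'a) \<Rightarrow> (nat \<Rightarrow> 'a)" where
  "corresponding_perm S F n x \<Phi> = (\<lambda>u\<in>power_set n (carrier F).
     THE v. v \<in> power_set n (carrier F) \<and> \<Phi> (endo_of S F n x u) = endo_of S F n x v)"

definition conj_power ::
  "nat \<Rightarrow> 'a set \<Rightarrow> ((nat \<Rightarrow> 'a) \<Rightarrow> (nat \<Rightarrow> 'a)) \<Rightarrow> ('a \<Rightarrow> 'a) \<Rightarrow> (nat \<Rightarrow> 'a) \<Rightarrow> (nat \<Rightarrow> 'a)" where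
  "conj_power n C \<psi> \<nu> = compose (power_set n C) \<psi>
     (compose (power_set n C) (map_power n C \<nu>) (inv_into (power_set n C) \<psi>))"

definition determines ::
  "('f \<Rightarrow> nat option) \<Rightarrow> ('f, 'a) algebra \<Rightarrow> nat \<Rightarrow> ((nat \<Rightarrow> 'a) \<Rightarrow> (nat \<Rightarrow> 'a))
     \<Rightarrow> (('a \<Rightarrow> 'a) \<Rightarrow> ('a \<Rightarrow> 'a)) \<Rightarrow> bool" where
  "determines S F n \<psi> \<Phi> \<longleftrightarrow>
     \<psi> \<in> Bij (power_set n (carrier F)) \<and> \<Phi> \<in> auto (End S F) \<and>
     (\<forall>\<nu>\<in>carrier (End S F).
        conj_power n (carrier F) \<psi> \<nu> ` Diagonal n (carrier F) \<subseteq> Diagonal n (carrier F) \<and>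
        \<Phi> \<nu> = compose (carrier F) (inv_into (carrier F) (diag n))
                (compose (carrier F) (conj_power n (carrier F) \<psi> \<nu>) (diag n)))"

definition equal_in_effect ::
  "('f \<Rightarrow> nat option) \<Rightarrow> ('f, 'a) algebra \<Rightarrow> nat \<Rightarrow> ((nat \<Rightarrow> 'a) \<Rightarrow> (nat \<Rightarrow> 'a))
     \<Rightarrow> ((nat \<Rightarrow> 'a) \<Rightarrow> (nat \<Rightarrow> 'a)) \<Rightarrow> bool" where
  "equal_in_effect S F n \<phi> \<psi> \<longleftrightarrow> (\<exists>\<Phi>. determines S F n \<phi> \<Phi> \<and> determines S F n \<psi> \<Phi>)"

end

theory Submission imports Defs begin

text \<open>
  Write \<open>C\<close> for the carrier of \<open>F\<close>. An endomorphism is the same thing as the tuple of its values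
  on the free generators, and under this identification composition on the left with \<open>\<nu>\<close> becomes
  the componentwise action \<open>\<nu>\<^sup>\<times>\<^sup>n\<close> on \<open>C\<^sup>n\<close>, because \<open>\<nu> \<circ> \<alpha>\<^sub>u = \<alpha>\<^sub>v\<close> for \<open>v = \<nu>\<^sup>\<times>\<^sup>n u\<close>. Applying \<open>\<Phi>\<close>
  to this equation gives \<open>\<phi> \<circ> \<nu>\<^sup>\<times>\<^sup>n = \<Phi>(\<nu>)\<^sup>\<times>\<^sup>n \<circ> \<phi>\<close>
  (\<open>corresponding_perm_map_power\<close>). Since \<open>\<Phi>(\<nu>)\<^sup>\<times>\<^sup>n\<close> acts on the diagonal as \<open>\<Phi>(\<nu>)\<close> acts on \<open>C\<close>,
  the permutation \<open>\<phi>\<close> determines \<open>\<Phi>\<close> (\<open>determines_corresponding_perm\<close>). A permutation of \<open>C\<^sup>n\<close>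
  determines at most one automorphism (\<open>determines_unique\<close>), so being equal in effect to \<open>\<phi>\<close> is
  the same as determining \<open>\<Phi>\<close>.

  It remains to see when a direct product \<open>s\<^sub>1 \<times> \<dots> \<times> s\<^sub>n\<close> determines \<open>\<Phi>\<close>. It carries \<open>\<nu>\<^sup>\<times>\<^sup>n\<close> to
  the map with components \<open>s\<^sub>i \<circ> \<nu> \<circ> s\<^sub>i\<^sup>-\<^sup>1\<close>. If \<open>\<Phi>\<close> is conjugation by \<open>s\<close>, then the choice
  \<open>s\<^sub>i = s\<close> determines \<open>\<Phi>\<close>. Conversely, if the product determines \<open>\<Phi>\<close>, then every
  component agrees with \<open>\<Phi>(\<nu>)\<close>; the first one already shows that \<open>\<Phi>\<close> is conjugation by \<open>s\<^sub>1\<close>.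
\<close>

text \<open>Simplified goals must keep matching the facts about the index set \<open>{1..n}\<close>.\<close>

declare One_nat_def [simp del]


section \<open>Permutations of a direct power\<close>

lemma diag_apply: "i \<in> {1..n} \<Longrightarrow> diag n a i = a"
  by (simp add: diag_def)

lemma diag_in_power_set: "a \<in> C \<Longrightarrow> diag n a \<in> power_set n C"
  by (auto simp: diag_def power_set_def)

lemma inv_into_diag:
  assumes "n \<ge> 1" "a \<in> C"
  shows "inv_into C (diag n) (diag n a) = a"
proof (rule inv_into_f_f)
  have "a = b" if "diag n a = diag n b" for a b :: 'a
    using that assms(1) diag_apply[of 1 n] by (metis atLeastAtMost_iff order_refl)
  then show "inj_on (diag n) C" by (auto intro: inj_onI)
qed (use assms in simp)

lemma power_setI:
  "(\<And>i. i \<in> {1..n} \<Longrightarrow> u i \<in> C) \<Longrightarrow> (\<lambda>i\<in>{1..n}. u i) \<in> power_set n C"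
  by (auto simp: power_set_def)

lemma power_set_apply: "u \<in> power_set n C \<Longrightarrow> i \<in> {1..n} \<Longrightarrow> u i \<in> C"
  by (auto simp: power_set_def)

lemma power_set_eqI:
  assumes "u \<in> power_set n C" "v \<in> power_set n C" "\<And>i. i \<in> {1..n} \<Longrightarrow> u i = v i"
  shows "u = v"
  using assms unfolding power_set_def by (rule PiE_ext)

lemma direct_product_apply:
  "u \<in> power_set n C \<Longrightarrow> i \<in> {1..n} \<Longrightarrow> direct_product n C s u i = s i (u i)"
  by (simp add: direct_product_def)

lemma direct_product_in_power_set:
  assumes "u \<in> power_set n C" "\<And>i. i \<in> {1..n} \<Longrightarrow> s i \<in> C \<rightarrow> C"
  shows "direct_product n C s u \<in> power_set n C"
proof -
  have "(\<lambda>i\<in>{1..n}. s i (u i)) \<in> power_set n C"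
    by (intro power_setI Pi_mem[OF assms(2)] power_set_apply[OF assms(1)])
  then show ?thesis using assms(1) by (simp add: direct_product_def)
qed

lemma map_power_apply:
  "u \<in> power_set n C \<Longrightarrow> i \<in> {1..n} \<Longrightarrow> map_power n C \<nu> u i = \<nu> (u i)"
  by (simp add: map_power_def direct_product_apply)

lemma map_power_in_power_set:
  "u \<in> power_set n C \<Longrightarrow> \<nu> \<in> C \<rightarrow> C \<Longrightarrow> map_power n C \<nu> u \<in> power_set n C"
  by (simp add: map_power_def direct_product_in_power_set)

lemma map_power_diag:
  assumes "a \<in> C" "\<nu> \<in> C \<rightarrow> C"
  shows "map_power n C \<nu> (diag n a) = diag n (\<nu> a)"
proof (rule power_set_eqI[of _ n C])
  show "map_power n C \<nu> (diag n a) \<in> power_set n C"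
    by (intro map_power_in_power_set diag_in_power_set assms)
  show "diag n (\<nu> a) \<in> power_set n C"
    by (intro diag_in_power_set Pi_mem[OF assms(2)] assms(1))
  show "map_power n C \<nu> (diag n a) i = diag n (\<nu> a) i" if "i \<in> {1..n}" for i
    using that assms(1) by (simp add: map_power_apply diag_apply diag_in_power_set)
qed

lemma Bij_inv_into:
  assumes "s \<in> Bij C" "a \<in> C"
  shows "inv_into C s a \<in> C" "s (inv_into C s a) = a" "inv_into C s (s a) = a"
  using assms by (auto simp: Bij_def bij_betw_def inv_into_into f_inv_into_f)

lemma Bij_apply: "s \<in> Bij C \<Longrightarrow> a \<in> C \<Longrightarrow> s a \<in> C"
  by (auto simp: Bij_def bij_betw_def)

lemma direct_product_Bij:
  assumes s: "\<And>i. i \<in> {1..n} \<Longrightarrow> s i \<in> Bij C"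
  shows "direct_product n C s \<in> Bij (power_set n C)"
proof -
  let ?P = "power_set n C"
  let ?t = "direct_product n C (\<lambda>i. inv_into C (s i))"
  have s_in: "direct_product n C s u \<in> ?P" if "u \<in> ?P" for u
    using that Bij_imp_funcset[OF s] by (rule direct_product_in_power_set)
  have t_in: "?t u \<in> ?P" if "u \<in> ?P" for u
    using that funcsetI[OF Bij_inv_into(1)[OF s]] by (rule direct_product_in_power_set)
  have "bij_betw (direct_product n C s) ?P ?P"
  proof (rule bij_betw_byWitness[of _ ?t])
    show "\<forall>u\<in>?P. ?t (direct_product n C s u) = u"
    proof
      fix u assume u: "u \<in> ?P"
      show "?t (direct_product n C s u) = u"
      proof (rule power_set_eqI[of _ n C])
        fix i assume i: "i \<in> {1..n}"
        then show "?t (direct_product n C s u) i = u i"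
          using s_in[OF u] u
          by (simp add: direct_product_apply Bij_inv_into(3)[OF s[OF i] power_set_apply[OF u i]])
      qed (intro s_in t_in u)+
    qed
    show "\<forall>u\<in>?P. direct_product n C s (?t u) = u"
    proof
      fix u assume u: "u \<in> ?P"
      show "direct_product n C s (?t u) = u"
      proof (rule power_set_eqI[of _ n C])
        fix i assume i: "i \<in> {1..n}"
        then show "direct_product n C s (?t u) i = u i"
          using t_in[OF u] u
          by (simp add: direct_product_apply Bij_inv_into(2)[OF s[OF i] power_set_apply[OF u i]])
      qed (intro s_in t_in u)+
    qed
  qed (use s_in t_in in auto)
  then show ?thesis by (simp add: Bij_def direct_product_def)
qed


section \<open>Automorphisms determined by a permutation\<close>

lemma carrier_End: "carrier (End S F) = alg_hom S F F"
  by (simp add: End_def)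

lemma mult_End: "mult (End S F) = compose (carrier F)"
  by (simp add: End_def)

lemma End_funcset: "\<nu> \<in> carrier (End S F) \<Longrightarrow> \<nu> \<in> carrier F \<rightarrow> carrier F"
  by (auto simp: End_def alg_hom_def)

lemma End_extensional: "\<nu> \<in> carrier (End S F) \<Longrightarrow> \<nu> \<in> extensional (carrier F)"
  by (simp add: End_def alg_hom_def PiE_iff)

lemma auto_in_End:
  "\<Phi> \<in> auto (End S F) \<Longrightarrow> \<nu> \<in> carrier (End S F) \<Longrightarrow> \<Phi> \<nu> \<in> carrier (End S F)"
  by (auto simp: auto_def hom_def)

lemma auto_compose:
  assumes "\<Phi> \<in> auto (End S F)" "\<mu> \<in> carrier (End S F)" "\<nu> \<in> carrier (End S F)"
  shows "\<Phi> (compose (carrier F) \<mu> \<nu>) = compose (carrier F) (\<Phi> \<mu>) (\<Phi> \<nu>)"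
  using assms by (auto simp: auto_def hom_def mult_End)

lemma compose_in_End:
  assumes F: "is_algebra S F" and \<mu>: "\<mu> \<in> carrier (End S F)" and \<nu>: "\<nu> \<in> carrier (End S F)"
  shows "compose (carrier F) \<mu> \<nu> \<in> carrier (End S F)"
  unfolding carrier_End alg_hom_def
proof (intro CollectI conjI allI impI)
  let ?C = "carrier F"
  show "compose ?C \<mu> \<nu> \<in> ?C \<rightarrow>\<^sub>E ?C"
    using End_funcset[OF \<mu>] End_funcset[OF \<nu>] by (auto simp: compose_def)
  fix f as assume f: "S f = Some (length as)" and as: "set as \<subseteq> ?C"
  have "ops F f as \<in> ?C" using F f as by (simp add: is_algebra_def)
  moreover have "\<nu> (ops F f as) = ops F f (map \<nu> as)"
    using \<nu> f as by (simp add: carrier_End alg_hom_def)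
  moreover have "set (map \<nu> as) \<subseteq> ?C" using as End_funcset[OF \<nu>] by auto
  then have "\<mu> (ops F f (map \<nu> as)) = ops F f (map \<mu> (map \<nu> as))"
    using \<mu> f by (simp add: carrier_End alg_hom_def)
  moreover have "map (compose ?C \<mu> \<nu>) as = map \<mu> (map \<nu> as)"
    using as by (auto simp: compose_def)
  ultimately show "compose ?C \<mu> \<nu> (ops F f as) = ops F f (map (compose ?C \<mu> \<nu>) as)"
    by (simp only: compose_eq)
qed

text \<open>
  Substituting \<open>v = \<psi>\<^sup>-\<^sup>1 (\<delta> a)\<close> removes \<open>\<psi>\<^sup>-\<^sup>1\<close> from the conjugation formula, and \<open>\<delta>\<^sup>-\<^sup>1\<close>
  moves to the other side as \<open>\<delta>\<close>, which is injective because tuples have at least one entry.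
\<close>

lemma determines_iff:
  assumes n: "n \<ge> 1" and \<psi>: "\<psi> \<in> Bij (power_set n (carrier F))" and \<Phi>: "\<Phi> \<in> auto (End S F)"
  shows "determines S F n \<psi> \<Phi> \<longleftrightarrow>
    (\<forall>\<nu>\<in>carrier (End S F). \<forall>v\<in>power_set n (carrier F). \<forall>a\<in>carrier F.
       \<psi> v = diag n a \<longrightarrow> \<psi> (map_power n (carrier F) \<nu> v) = diag n (\<Phi> \<nu> a))"
    (is "_ \<longleftrightarrow> ?R")
proof
  let ?C = "carrier F"
  let ?P = "power_set n (carrier F)"
  have conj: "conj_power n ?C \<psi> \<nu> (diag n a) =
      \<psi> (map_power n ?C \<nu> (inv_into ?P \<psi> (diag n a)))" if "a \<in> ?C" for \<nu> a
    using that by (simp add: conj_power_def compose_eq diag_in_power_set)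
  show ?R if det: "determines S F n \<psi> \<Phi>"
  proof (intro ballI impI)
    fix \<nu> v a assume \<nu>: "\<nu> \<in> carrier (End S F)" and v: "v \<in> ?P" and a: "a \<in> ?C"
      and va: "\<psi> v = diag n a"
    have "inv_into ?P \<psi> (diag n a) = v"
      using Bij_inv_into(3)[OF \<psi> v] va by simp
    then have c: "conj_power n ?C \<psi> \<nu> (diag n a) = \<psi> (map_power n ?C \<nu> v)"
      using conj[OF a] by simp
    have "conj_power n ?C \<psi> \<nu> (diag n a) \<in> Diagonal n ?C"
      using det \<nu> a unfolding determines_def Diagonal_def by blast
    then obtain b where b: "b \<in> ?C" "conj_power n ?C \<psi> \<nu> (diag n a) = diag n b"
      by (auto simp: Diagonal_def)
    have "\<Phi> \<nu> = compose ?C (inv_into ?C (diag n))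
                  (compose ?C (conj_power n ?C \<psi> \<nu>) (diag n))"
      using det \<nu> unfolding determines_def by blast
    then have "\<Phi> \<nu> a = inv_into ?C (diag n) (conj_power n ?C \<psi> \<nu> (diag n a))"
      using a by (simp add: compose_eq)
    then have "\<Phi> \<nu> a = b" using b n by (simp add: inv_into_diag)
    then show "\<psi> (map_power n ?C \<nu> v) = diag n (\<Phi> \<nu> a)" using b c by simp
  qed
  show "determines S F n \<psi> \<Phi>" if R: ?R
    unfolding determines_def
  proof (intro conjI ballI \<psi> \<Phi>)
    fix \<nu> assume \<nu>: "\<nu> \<in> carrier (End S F)"
    have \<Phi>\<nu>: "\<Phi> \<nu> \<in> carrier (End S F)" by (rule auto_in_End[OF \<Phi> \<nu>])
    have in_C: "\<Phi> \<nu> a \<in> ?C" if "a \<in> ?C" for a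
      using End_funcset[OF \<Phi>\<nu>] that by auto
    have eq: "conj_power n ?C \<psi> \<nu> (diag n a) = diag n (\<Phi> \<nu> a)" if a: "a \<in> ?C" for a
      using conj[OF a] R \<nu> a Bij_inv_into(1,2)[OF \<psi> diag_in_power_set[OF a]] by simp
    show "conj_power n ?C \<psi> \<nu> ` Diagonal n ?C \<subseteq> Diagonal n ?C"
      using eq in_C by (auto simp: Diagonal_def)
    show "\<Phi> \<nu> = compose ?C (inv_into ?C (diag n))
                  (compose ?C (conj_power n ?C \<psi> \<nu>) (diag n))"
    proof (rule extensionalityI[of _ ?C])
      fix a assume a: "a \<in> ?C"
      then show "\<Phi> \<nu> a = compose ?C (inv_into ?C (diag n))
                  (compose ?C (conj_power n ?C \<psi> \<nu>) (diag n)) a"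
        using n in_C by (simp add: compose_eq eq inv_into_diag)
    qed (use End_extensional[OF \<Phi>\<nu>] in \<open>auto simp: compose_def\<close>)
  qed
qed

lemma determines_unique:
  assumes "determines S F n \<psi> \<Phi>" "determines S F n \<psi> \<Phi>'"
  shows "\<Phi> = \<Phi>'"
proof (rule extensionalityI[of _ "carrier (End S F)"])
  show "\<Phi> \<in> extensional (carrier (End S F))" "\<Phi>' \<in> extensional (carrier (End S F))"
    using assms by (auto simp: determines_def auto_def Bij_def)
  fix \<nu> assume "\<nu> \<in> carrier (End S F)"
  then show "\<Phi> \<nu> = \<Phi>' \<nu>" using assms by (simp add: determines_def)
qed

lemma equal_in_effect_iff:
  assumes "determines S F n \<phi> \<Phi>"
  shows "equal_in_effect S F n \<phi> \<psi> \<longleftrightarrow> determines S F n \<psi> \<Phi>"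
  using assms determines_unique unfolding equal_in_effect_def by blast

text \<open>
  The product conjugates \<open>\<nu>\<^sup>\<times>\<^sup>n\<close> to the map with components \<open>s\<^sub>i \<circ> \<nu> \<circ> s\<^sub>i\<^sup>-\<^sup>1\<close>, so on the diagonal it
  has the effect of \<open>\<Phi>(\<nu>)\<close> exactly if each of these components equals \<open>\<Phi>(\<nu>)\<close>.
\<close>

lemma determines_direct_product_iff:
  assumes n: "n \<ge> 1" and s: "\<And>i. i \<in> {1..n} \<Longrightarrow> s i \<in> Bij (carrier F)"
    and \<Phi>: "\<Phi> \<in> auto (End S F)"
  shows "determines S F n (direct_product n (carrier F) s) \<Phi> \<longleftrightarrow>
    (\<forall>\<nu>\<in>carrier (End S F). \<forall>i\<in>{1..n}.
       \<Phi> \<nu> = compose (carrier F) (s i) (compose (carrier F) \<nu> (inv_into (carrier F) (s i))))"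
    (is "?L \<longleftrightarrow> ?R")
proof
  let ?C = "carrier F"
  let ?P = "power_set n ?C"
  let ?\<psi> = "direct_product n ?C s"
  have \<psi>: "?\<psi> \<in> Bij ?P" by (rule direct_product_Bij) (rule s)
  note iff = determines_iff[OF n \<psi> \<Phi>]
  show ?R if L: ?L
  proof (intro ballI)
    fix \<nu> i assume \<nu>: "\<nu> \<in> carrier (End S F)" and i: "i \<in> {1..n}"
    show "\<Phi> \<nu> = compose ?C (s i) (compose ?C \<nu> (inv_into ?C (s i)))"
    proof (rule extensionalityI[of _ ?C])
      fix a assume a: "a \<in> ?C"
      \<comment> \<open>the preimage of \<open>\<delta> a\<close> under the product\<close>
      let ?v = "\<lambda>j\<in>{1..n}. inv_into ?C (s j) a"
      have v: "?v \<in> ?P"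
        using Bij_inv_into(1)[OF s a] by (intro power_setI)
      have "?\<psi> ?v = diag n a"
      proof (rule power_set_eqI[of _ n ?C])
        show "?\<psi> ?v \<in> ?P" by (rule Bij_apply[OF \<psi> v])
        show "diag n a \<in> ?P" by (rule diag_in_power_set[OF a])
        fix j assume j: "j \<in> {1..n}"
        then show "?\<psi> ?v j = diag n a j"
          using Bij_inv_into(2)[OF s[OF j] a] by (simp add: direct_product_apply[OF v] diag_apply)
      qed
      then have "?\<psi> (map_power n ?C \<nu> ?v) = diag n (\<Phi> \<nu> a)"
        using L iff \<nu> v a by blast
      then have "?\<psi> (map_power n ?C \<nu> ?v) i = \<Phi> \<nu> a"
        using i by (simp add: diag_apply)
      then show "\<Phi> \<nu> a = compose ?C (s i) (compose ?C \<nu> (inv_into ?C (s i))) a"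
        using a i v map_power_in_power_set[OF v End_funcset[OF \<nu>]]
        by (simp add: compose_eq direct_product_apply map_power_apply)
    qed (use End_extensional[OF auto_in_End[OF \<Phi> \<nu>]] in \<open>auto simp: compose_def\<close>)
  qed
  show ?L if R: ?R
    unfolding iff
  proof (intro ballI impI)
    fix \<nu> v a assume \<nu>: "\<nu> \<in> carrier (End S F)" and v: "v \<in> ?P" and a: "a \<in> ?C"
      and va: "?\<psi> v = diag n a"
    have \<nu>v: "map_power n ?C \<nu> v \<in> ?P" by (rule map_power_in_power_set[OF v End_funcset[OF \<nu>]])
    show "?\<psi> (map_power n ?C \<nu> v) = diag n (\<Phi> \<nu> a)"
    proof (rule power_set_eqI[of _ n ?C])
      show "?\<psi> (map_power n ?C \<nu> v) \<in> ?P" by (rule Bij_apply[OF \<psi> \<nu>v])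
      show "diag n (\<Phi> \<nu> a) \<in> ?P"
        using End_funcset[OF auto_in_End[OF \<Phi> \<nu>]] a by (auto intro: diag_in_power_set)
      fix i assume i: "i \<in> {1..n}"
      have "s i (v i) = a"
        using va i direct_product_apply[OF v i, of s] by (simp add: diag_apply)
      then have "inv_into ?C (s i) a = v i"
        using Bij_inv_into(3)[OF s[OF i] power_set_apply[OF v i]] by simp
      moreover have "\<Phi> \<nu> a = compose ?C (s i) (compose ?C \<nu> (inv_into ?C (s i))) a"
        using R \<nu> i by metis
      ultimately have "\<Phi> \<nu> a = s i (\<nu> (v i))" using a by (simp add: compose_eq)
      then show "?\<psi> (map_power n ?C \<nu> v) i = diag n (\<Phi> \<nu> a) i"
        using i v \<nu>v by (simp add: direct_product_apply map_power_apply diag_apply)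
    qed
  qed
qed


section \<open>The permutation corresponding to an automorphism\<close>

locale free_algebra =
  fixes S :: "'f \<Rightarrow> nat option"
    and E :: "(('f, nat) trm \<times> ('f, nat) trm) set"
    and F :: "('f, 'a) algebra"
    and n :: nat
    and x :: "nat \<Rightarrow> 'a"
  assumes identities: "is_identities S E"
    and inj: "inj_on x {1..n}"
    and free: "freely_generated S E F (x ` {1..n})"
begin

abbreviation "C \<equiv> carrier F"
abbreviation "P \<equiv> power_set n C"
abbreviation "\<alpha> \<equiv> endo_of S F n x"

lemma algebra: "is_algebra S F"
  using free by (simp add: freely_generated_def in_variety_def)

lemma generator_in_carrier: "i \<in> {1..n} \<Longrightarrow> x i \<in> C"
  using free by (auto simp: freely_generated_def)

lemma ex1_endo:
  assumes u: "u \<in> P"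
  shows "\<exists>!\<nu>. \<nu> \<in> carrier (End S F) \<and> (\<forall>i\<in>{1..n}. \<nu> (x i) = u i)"
proof -
  let ?g = "u \<circ> inv_into {1..n} x"
  have g: "?g (x i) = u i" if "i \<in> {1..n}" for i
    using that inj by simp
  have "?g \<in> x ` {1..n} \<rightarrow> C" using g u by (auto simp del: comp_apply dest: power_set_apply)
  moreover have "in_variety S E F" using free by (simp add: freely_generated_def)
  ultimately have "\<exists>!\<nu>. \<nu> \<in> alg_hom S F F \<and> (\<forall>a\<in>x ` {1..n}. \<nu> a = ?g a)"
    by (intro freely_generated_extension[OF free identities])
  moreover have "(\<forall>a\<in>x ` {1..n}. \<nu> a = ?g a) \<longleftrightarrow> (\<forall>i\<in>{1..n}. \<nu> (x i) = u i)" for \<nu>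
    using g by (metis (no_types, lifting) image_iff)
  ultimately show ?thesis by (simp only: carrier_End)
qed

lemma endo_of_in_End: "u \<in> P \<Longrightarrow> \<alpha> u \<in> carrier (End S F)"
  using theI'[OF ex1_endo] by (simp add: endo_of_def)

lemma endo_of_generator: "u \<in> P \<Longrightarrow> i \<in> {1..n} \<Longrightarrow> \<alpha> u (x i) = u i"
  using theI'[OF ex1_endo] by (simp add: endo_of_def)

lemma endo_of_eqI:
  assumes "u \<in> P" "\<nu> \<in> carrier (End S F)" "\<And>i. i \<in> {1..n} \<Longrightarrow> \<nu> (x i) = u i"
  shows "\<alpha> u = \<nu>"
  using ex1_endo[OF assms(1)] endo_of_in_End[OF assms(1)] endo_of_generator[OF assms(1)] assms(2,3)
  by blast

lemma bij_betw_endo_of: "bij_betw \<alpha> P (carrier (End S F))"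
proof (rule bij_betwI')
  fix u v assume u: "u \<in> P" and v: "v \<in> P"
  show "\<alpha> u = \<alpha> v \<longleftrightarrow> u = v"
    using endo_of_generator[OF u] endo_of_generator[OF v] power_set_eqI[OF u v] by metis
next
  fix \<nu> assume \<nu>: "\<nu> \<in> carrier (End S F)"
  let ?u = "\<lambda>i\<in>{1..n}. \<nu> (x i)"
  have u: "?u \<in> P"
    using End_funcset[OF \<nu>] generator_in_carrier by (intro power_setI) auto
  moreover have "\<alpha> ?u = \<nu>" by (rule endo_of_eqI[OF u \<nu>]) simp
  ultimately show "\<exists>u\<in>P. \<nu> = \<alpha> u" by metis
qed (rule endo_of_in_End)

lemma compose_endo_of:
  assumes "\<nu> \<in> carrier (End S F)" "u \<in> P"
  shows "compose C \<nu> (\<alpha> u) = \<alpha> (map_power n C \<nu> u)"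
proof (rule endo_of_eqI[symmetric])
  show "map_power n C \<nu> u \<in> P"
    by (rule map_power_in_power_set[OF assms(2) End_funcset[OF assms(1)]])
  show "compose C \<nu> (\<alpha> u) \<in> carrier (End S F)"
    by (intro compose_in_End algebra assms endo_of_in_End)
  show "compose C \<nu> (\<alpha> u) (x i) = map_power n C \<nu> u i" if "i \<in> {1..n}" for i
    using that assms(2)
    by (simp only: compose_eq generator_in_carrier endo_of_generator map_power_apply)
qed

context
  fixes \<Phi> :: "('a \<Rightarrow> 'a) \<Rightarrow> ('a \<Rightarrow> 'a)"
  assumes \<Phi>: "\<Phi> \<in> auto (End S F)"
begin

abbreviation "\<phi> \<equiv> corresponding_perm S F n x \<Phi>"

text \<open>
  The definite description is meaningful because \<open>\<alpha>\<close> is a bijection from tuples to endomorphisms;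
  \<open>\<phi>\<close> is \<open>\<Phi>\<close> transported along it.
\<close>

lemma corresponding_perm:
  assumes u: "u \<in> P"
  shows "\<phi> u \<in> P" "\<alpha> (\<phi> u) = \<Phi> (\<alpha> u)"
proof -
  have "\<Phi> (\<alpha> u) \<in> carrier (End S F)" by (intro auto_in_End[OF \<Phi>] endo_of_in_End u)
  then have "\<exists>!v. v \<in> P \<and> \<Phi> (\<alpha> u) = \<alpha> v"
    using bij_betw_endo_of by (auto simp: bij_betw_def inj_on_def)
  from theI'[OF this] show "\<phi> u \<in> P" "\<alpha> (\<phi> u) = \<Phi> (\<alpha> u)"
    using u by (simp_all add: corresponding_perm_def)
qed

lemma corresponding_perm_Bij: "\<phi> \<in> Bij P"
proof -
  have "bij_betw \<Phi> (carrier (End S F)) (carrier (End S F))"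
    using \<Phi> by (simp add: auto_def Bij_def)
  with bij_betw_endo_of have "bij_betw (\<Phi> \<circ> \<alpha>) P (carrier (End S F))"
    by (rule bij_betw_trans)
  moreover have "(\<Phi> \<circ> \<alpha>) u = (\<alpha> \<circ> \<phi>) u" if "u \<in> P" for u
    using corresponding_perm(2)[OF that] by simp
  ultimately have "bij_betw (\<alpha> \<circ> \<phi>) P (carrier (End S F))"
    by (simp cong: bij_betw_cong)
  moreover have "\<phi> ` P \<subseteq> P" using corresponding_perm(1) by auto
  ultimately have "bij_betw \<phi> P P"
    using bij_betw_comp_iff2[OF bij_betw_endo_of] by blast
  then show ?thesis by (simp add: Bij_def corresponding_perm_def)
qed

text \<open>
  This is the image under \<open>\<Phi>\<close> of the equation \<open>\<nu> \<circ> \<alpha>\<^sub>u = \<alpha>\<^sub>v\<close>, where \<open>v = \<nu>\<^sup>\<times>\<^sup>n u\<close>, read in terms of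
  tuples.
\<close>

lemma corresponding_perm_map_power:
  assumes \<nu>: "\<nu> \<in> carrier (End S F)" and u: "u \<in> P"
  shows "\<phi> (map_power n C \<nu> u) = map_power n C (\<Phi> \<nu>) (\<phi> u)"
proof -
  have \<Phi>\<nu>: "\<Phi> \<nu> \<in> carrier (End S F)" by (rule auto_in_End[OF \<Phi> \<nu>])
  have \<nu>u: "map_power n C \<nu> u \<in> P" by (rule map_power_in_power_set[OF u End_funcset[OF \<nu>]])
  have "\<alpha> (\<phi> (map_power n C \<nu> u)) = \<Phi> (compose C \<nu> (\<alpha> u))"
    using corresponding_perm(2)[OF \<nu>u] compose_endo_of[OF \<nu> u] by simp
  also have "\<dots> = compose C (\<Phi> \<nu>) (\<alpha> (\<phi> u))"
    using auto_compose[OF \<Phi> \<nu> endo_of_in_End[OF u]] corresponding_perm(2)[OF u] by simp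
  also have "\<dots> = \<alpha> (map_power n C (\<Phi> \<nu>) (\<phi> u))"
    by (rule compose_endo_of[OF \<Phi>\<nu> corresponding_perm(1)[OF u]])
  finally show ?thesis
    using bij_betw_endo_of corresponding_perm(1) u \<nu>u map_power_in_power_set End_funcset[OF \<Phi>\<nu>]
    by (metis bij_betw_imp_inj_on inj_onD)
qed

lemma determines_corresponding_perm:
  assumes "n \<ge> 1"
  shows "determines S F n \<phi> \<Phi>"
  unfolding determines_iff[OF assms corresponding_perm_Bij \<Phi>]
  using corresponding_perm_map_power map_power_diag End_funcset auto_in_End[OF \<Phi>] by metis

end

end


section \<open>Quasi-inner automorphisms\<close>

theorem corollary1:
  fixes S :: "'f \<Rightarrow> nat option"
    and E :: "(('f, nat) trm \<times> ('f, nat) trm) set"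
    and F :: "('f, 'a) algebra"
    and n :: nat
    and x :: "nat \<Rightarrow> 'a"
    and \<Phi> :: "('a \<Rightarrow> 'a) \<Rightarrow> ('a \<Rightarrow> 'a)"
    and \<phi> :: "(nat \<Rightarrow> 'a) \<Rightarrow> (nat \<Rightarrow> 'a)"
  assumes "is_identities S E"
    and "n \<ge> 1"
    and "inj_on x {1..n}"
    and "freely_generated S E F (x ` {1..n})"
    and "\<Phi> \<in> auto (End S F)"
    and "\<phi> = corresponding_perm S F n x \<Phi>"
  shows "quasi_inner S F \<Phi> \<longleftrightarrow>
    (\<exists>s. (\<forall>i\<in>{1..n}. s i \<in> Bij (carrier F)) \<and>
         equal_in_effect S F n \<phi> (direct_product n (carrier F) s))"
proof -
  interpret free_algebra S E F n x
    using assms(1,3,4) by unfold_locales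
  have "determines S F n \<phi> \<Phi>"
    using determines_corresponding_perm[OF assms(5,2)] assms(6) by simp
  note effect = equal_in_effect_iff[OF this]
  show ?thesis
    unfolding effect
  proof
    assume "quasi_inner S F \<Phi>"
    then obtain s where "s \<in> Bij (carrier F)"
      and "\<forall>\<nu>\<in>carrier (End S F).
        \<Phi> \<nu> = compose (carrier F) s (compose (carrier F) \<nu> (inv_into (carrier F) s))"
      by (auto simp: quasi_inner_def)
    then have "determines S F n (direct_product n (carrier F) (\<lambda>i. s)) \<Phi>"
      using determines_direct_product_iff[OF assms(2) _ assms(5), of "\<lambda>i. s"] by blast
    then show "\<exists>s. (\<forall>i\<in>{1..n}. s i \<in> Bij (carrier F)) \<and>
        determines S F n (direct_product n (carrier F) s) \<Phi>"
      using \<open>s \<in> Bij (carrier F)\<close> by (intro exI[of _ "\<lambda>i. s"]) simp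
  next
    assume "\<exists>s. (\<forall>i\<in>{1..n}. s i \<in> Bij (carrier F)) \<and>
        determines S F n (direct_product n (carrier F) s) \<Phi>"
    then obtain s where s: "\<forall>i\<in>{1..n}. s i \<in> Bij (carrier F)"
      and det: "determines S F n (direct_product n (carrier F) s) \<Phi>"
      by blast
    have first: "1 \<in> {1..n}" using assms(2) by simp
    have "\<forall>\<nu>\<in>carrier (End S F). \<forall>i\<in>{1..n}.
        \<Phi> \<nu> = compose (carrier F) (s i) (compose (carrier F) \<nu> (inv_into (carrier F) (s i)))"
      by (rule iffD1[OF determines_direct_product_iff[OF assms(2) _ assms(5)] det])
        (rule bspec[OF s])
    then show "quasi_inner S F \<Phi>"
      unfolding quasi_inner_def using bspec[OF s first] first by (intro bexI[of _ "s 1"]) auto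
  qed
qed

end
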